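(* Let $G$ be a countable residually RAAG group. Then there exists an injective group homomorphism $G\to\operatorname{PL}_+(\mathbb{R})$.
   Context: For a finite simplicial graph $\Gamma$ with vertex set $V(\Gamma)$ and edge set $E(\Gamma)$, the right-angled Artin group $A(\Gamma)$ is the group with generating set $V(\Gamma)$ and defining relations $[v_i,v_j]=1$ for exactly those pairs of vertices with $\{v_i,v_j\}\in E(\Gamma)$. A group $G$ is a residually RAAG group if for each $1\neq g\in G$ there exist a finite simplicial graph $\Gamma_g$ and a group homomorphism $\phi_g\colon G\to A(\Gamma_g)$ such that $\phi_g(g)\neq 1$. $\operatorname{PL}_+(\mathbb{R})$ denotes the group, under composition, of orientation preserving piecewise-linear homeomorphisms of $\mathbb{R}$; infinitely many domains of linearity are allowed (the set of breakpoints is a closed discrete, possibly infinite, subset of $\mathbb{R}$). *)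

theory Defs
  imports "HOL-Algebra.Group" "HOL-Analysis.Analysis"
begin

section \<open>Groups given by presentations\<close>

text \<open>The letter \<open>(x, True)\<close> stands for the generator \<open>x\<close> and \<open>(x, False)\<close> for its formal
  inverse.\<close>

type_synonym 'v word = "('v \<times> bool) list"

definition words_over :: "'v set \<Rightarrow> 'v word set" where
  "words_over S = lists (S \<times> UNIV)"

text \<open>The least congruence on the words over \<open>S\<close> that makes inverse letters cancel
  and all relators in \<open>R\<close> trivial.\<close>

inductive pres_cong :: "'v set \<Rightarrow> 'v word set \<Rightarrow> 'v word \<Rightarrow> 'v word \<Rightarrow> bool"
  for S R where
  refl: "u \<in> words_over S \<Longrightarrow> pres_cong S R u u"
| sym: "pres_cong S R u v \<Longrightarrow> pres_cong S R v u"
| trans: "pres_cong S R u v \<Longrightarrow> pres_cong S R v w \<Longrightarrow> pres_cong S R u w"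
| append: "pres_cong S R u u' \<Longrightarrow> pres_cong S R v v' \<Longrightarrow> pres_cong S R (u @ v) (u' @ v')"
| cancel: "x \<in> S \<Longrightarrow> pres_cong S R [(x, b), (x, \<not> b)] []"
| relator: "r \<in> R \<Longrightarrow> r \<in> words_over S \<Longrightarrow> pres_cong S R r []"

definition pres_rel :: "'v set \<Rightarrow> 'v word set \<Rightarrow> 'v word rel" where
  "pres_rel S R = {(u, v). pres_cong S R u v}"

definition presented_group :: "'v set \<Rightarrow> 'v word set \<Rightarrow> 'v word set monoid" where
  "presented_group S R =
    \<lparr>carrier = words_over S // pres_rel S R,
     monoid.mult = (\<lambda>A B. \<Union>u\<in>A. \<Union>v\<in>B. pres_rel S R `` {u @ v}),
     one = pres_rel S R `` {[]}\<rparr>"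

lemma words_over_append_iff [simp]:
  "u @ v \<in> words_over S \<longleftrightarrow> u \<in> words_over S \<and> v \<in> words_over S"
  by (auto simp: words_over_def)

lemma words_over_Nil [simp]: "[] \<in> words_over S"
  by (simp add: words_over_def)

lemma words_over_Cons [simp]: "(x, b) # u \<in> words_over S \<longleftrightarrow> x \<in> S \<and> u \<in> words_over S"
  by (auto simp: words_over_def)

lemma pres_cong_words:
  "pres_cong S R u v \<Longrightarrow> u \<in> words_over S \<and> v \<in> words_over S"
  by (induction rule: pres_cong.induct) auto

lemma equiv_pres_rel: "equiv (words_over S) (pres_rel S R)"
  by (rule equivI)
    (auto simp: pres_rel_def refl_on_def sym_def trans_def
       dest: pres_cong_words intro: pres_cong.refl pres_cong.sym pres_cong.trans)

lemma pres_class_eq_iff: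
  assumes "u \<in> words_over S" "v \<in> words_over S"
  shows "pres_rel S R `` {u} = pres_rel S R `` {v} \<longleftrightarrow> pres_cong S R u v"
  using eq_equiv_class_iff[OF equiv_pres_rel assms] by (simp add: pres_rel_def)

lemma pres_mult_class:
  assumes "u \<in> words_over S" "v \<in> words_over S"
  shows "pres_rel S R `` {u} \<otimes>\<^bsub>presented_group S R\<^esub> pres_rel S R `` {v}
    = pres_rel S R `` {u @ v}"
proof -
  let ?A = "pres_rel S R `` {u}" and ?B = "pres_rel S R `` {v}"
    and ?C = "pres_rel S R `` {u @ v}"
  have eq: "pres_rel S R `` {u' @ v'} = ?C" if "u' \<in> ?A" "v' \<in> ?B" for u' v'
  proof -
    have "pres_cong S R u u'" "pres_cong S R v v'" using that by (auto simp: pres_rel_def)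
    then have "pres_cong S R (u' @ v') (u @ v)"
      by (intro pres_cong.sym[OF pres_cong.append])
    then show ?thesis
      using pres_class_eq_iff[of "u' @ v'" S "u @ v" R] pres_cong_words by blast
  qed
  have "u \<in> ?A" "v \<in> ?B"
    using assms by (auto simp: pres_rel_def intro: pres_cong.refl)
  then have "(\<Union>u'\<in>?A. \<Union>v'\<in>?B. pres_rel S R `` {u' @ v'}) = ?C"
    using eq by (intro equalityI UN_least) blast+
  then show ?thesis by (simp add: presented_group_def)
qed

lemma pres_carrierE:
  assumes "A \<in> carrier (presented_group S R)"
  obtains u where "u \<in> words_over S" "A = pres_rel S R `` {u}"
  using assms by (auto simp: presented_group_def elim: quotientE)

lemma pres_class_in_carrier:
  "u \<in> words_over S \<Longrightarrow> pres_rel S R `` {u} \<in> carrier (presented_group S R)"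
  by (auto simp: presented_group_def intro: quotientI)

lemma pres_one: "\<one>\<^bsub>presented_group S R\<^esub> = pres_rel S R `` {[]}"
  by (simp add: presented_group_def)

lemma pres_left_inverse:
  "u \<in> words_over S \<Longrightarrow> \<exists>v\<in>words_over S. pres_cong S R (v @ u) []"
proof (induction u)
  case Nil
  then show ?case by (intro bexI[of _ "[]"]) (auto intro: pres_cong.refl)
next
  case (Cons a u)
  obtain x b where a: "a = (x, b)" by (cases a)
  with Cons obtain v where v: "v \<in> words_over S" "pres_cong S R (v @ u) []" and x: "x \<in> S"
    and u: "u \<in> words_over S"
    by auto
  have c: "pres_cong S R [(x, \<not> b), (x, b)] []"
    using pres_cong.cancel[OF x, of R "\<not> b"] by simp
  have "pres_cong S R (v @ [(x, \<not> b), (x, b)] @ u) (v @ [] @ u)"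
    using v u by (intro pres_cong.append c pres_cong.refl)
  then have "pres_cong S R ((v @ [(x, \<not> b)]) @ a # u) []"
    using v(2) a by (auto intro: pres_cong.trans)
  then show ?case using v(1) x by (intro bexI[of _ "v @ [(x, \<not> b)]"]) auto
qed

lemma group_presented_group: "group (presented_group S R)"
proof (rule groupI)
  fix A B C assume "A \<in> carrier (presented_group S R)" "B \<in> carrier (presented_group S R)"
    "C \<in> carrier (presented_group S R)"
  then show "A \<otimes>\<^bsub>presented_group S R\<^esub> B \<otimes>\<^bsub>presented_group S R\<^esub> C
      = A \<otimes>\<^bsub>presented_group S R\<^esub> (B \<otimes>\<^bsub>presented_group S R\<^esub> C)"
    by (auto elim!: pres_carrierE simp: pres_mult_class)
next
  fix A assume "A \<in> carrier (presented_group S R)"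
  then obtain u where u: "u \<in> words_over S" "A = pres_rel S R `` {u}" by (rule pres_carrierE)
  obtain v where v: "v \<in> words_over S" "pres_cong S R (v @ u) []"
    using pres_left_inverse[OF u(1)] by blast
  show "\<exists>B\<in>carrier (presented_group S R). B \<otimes>\<^bsub>presented_group S R\<^esub> A = \<one>\<^bsub>presented_group S R\<^esub>"
    using u v by (intro bexI[of _ "pres_rel S R `` {v}"])
      (auto simp: pres_mult_class pres_one pres_class_eq_iff intro: pres_class_in_carrier)
qed (auto elim!: pres_carrierE simp: pres_mult_class pres_one pres_class_in_carrier)

section \<open>Right-angled Artin groups\<close>

definition finite_simplicial_graph :: "'v set \<Rightarrow> 'v set set \<Rightarrow> bool" where
  "finite_simplicial_graph V E \<longleftrightarrow> finite V \<and> (\<forall>e\<in>E. e \<subseteq> V \<and> card e = 2)"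

definition commutator_word :: "'v \<Rightarrow> 'v \<Rightarrow> 'v word" where
  "commutator_word v w = [(v, True), (w, True), (v, False), (w, False)]"

definition raag :: "'v set \<Rightarrow> 'v set set \<Rightarrow> 'v word set monoid" where
  "raag V E = presented_group V {commutator_word v w | v w. v \<in> V \<and> w \<in> V \<and> {v, w} \<in> E}"

lemma group_raag: "group (raag V E)"
  by (simp add: raag_def group_presented_group)

text \<open>The vertices are taken from \<^typ>\<open>nat\<close>, since a type cannot be quantified over.
  This is no restriction: see \<open>finite_raag_iso_nat\<close> and \<open>residually_RAAGI\<close> below.\<close>

definition residually_RAAG :: "('g, 'm) monoid_scheme \<Rightarrow> bool" where
  "residually_RAAG G \<longleftrightarrow>
    (\<forall>g\<in>carrier G. g \<noteq> \<one>\<^bsub>G\<^esub> \<longrightarrow>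
      (\<exists>(V :: nat set) E \<phi>. finite_simplicial_graph V E \<and> \<phi> \<in> hom G (raag V E)
         \<and> \<phi> g \<noteq> \<one>\<^bsub>raag V E\<^esub>))"

definition relabel :: "('v \<Rightarrow> 'w) \<Rightarrow> 'v word \<Rightarrow> 'w word" where
  "relabel f = map (\<lambda>(x, b). (f x, b))"

lemma relabel_simps [simp]:
  "relabel f [] = []"
  "relabel f ((x, b) # u) = (f x, b) # relabel f u"
  "relabel f (u @ v) = relabel f u @ relabel f v"
  by (simp_all add: relabel_def)

lemma relabel_words: "u \<in> words_over S \<Longrightarrow> relabel f u \<in> words_over (f ` S)"
  by (induction u) auto

lemma pres_cong_relabel:
  "pres_cong S R u v \<Longrightarrow> pres_cong (f ` S) (relabel f ` R) (relabel f u) (relabel f v)"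
  by (induction rule: pres_cong.induct)
    (auto intro: pres_cong.intros relabel_words)

lemma relabel_inv:
  assumes "inj_on f S" "u \<in> words_over S"
  shows "relabel (inv_into S f) (relabel f u) = u"
  using assms(2) by (induction u) (auto simp: assms(1))

lemma presented_group_relabel_iso:
  assumes f: "inj_on f S" and R: "R \<subseteq> words_over S"
  shows "presented_group S R \<cong> presented_group (f ` S) (relabel f ` R)"
proof -
  let ?g = "inv_into S f" and ?G = "presented_group S R"
    and ?H = "presented_group (f ` S) (relabel f ` R)"
  have gf: "?g ` f ` S = S" using f by (auto simp: image_image)
  have gR: "relabel ?g ` relabel f ` R = R"
  proof -
    have "relabel ?g ` relabel f ` R = (\<lambda>u. u) ` R"
      unfolding image_image using relabel_inv[OF f] R by (intro image_cong) auto
    then show ?thesis by simp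
  qed
  define h where "h A = pres_rel (f ` S) (relabel f ` R) `` (relabel f ` A)" for A
  have h: "h (pres_rel S R `` {u}) = pres_rel (f ` S) (relabel f ` R) `` {relabel f u}"
    if u: "u \<in> words_over S" for u
    unfolding h_def using u
    by (auto simp: pres_rel_def intro: pres_cong.refl pres_cong.trans dest: pres_cong_relabel)
  have iff: "pres_cong (f ` S) (relabel f ` R) (relabel f u) (relabel f v) \<longleftrightarrow> pres_cong S R u v"
    if "u \<in> words_over S" "v \<in> words_over S" for u v
    using pres_cong_relabel[of "f ` S" "relabel f ` R" "relabel f u" "relabel f v" ?g]
      pres_cong_relabel[of S R u v f]
    unfolding gf gR relabel_inv[OF f that(1)] relabel_inv[OF f that(2)] by blast
  have "h \<in> hom ?G ?H"
    by (rule homI) (auto elim!: pres_carrierE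
        simp: h pres_mult_class relabel_words pres_class_in_carrier)
  moreover have "inj_on h (carrier ?G)"
  proof (rule inj_onI)
    fix A B assume AB: "A \<in> carrier ?G" "B \<in> carrier ?G" "h A = h B"
    obtain u where u: "u \<in> words_over S" "A = pres_rel S R `` {u}"
      using AB(1) by (rule pres_carrierE)
    obtain v where v: "v \<in> words_over S" "B = pres_rel S R `` {v}"
      using AB(2) by (rule pres_carrierE)
    show "A = B"
      using AB(3) iff[OF u(1) v(1)] unfolding u(2) v(2) h[OF u(1)] h[OF v(1)]
      by (simp add: pres_class_eq_iff u(1) v(1) relabel_words)
  qed
  moreover have "h ` carrier ?G = carrier ?H"
  proof (intro equalityI subsetI)
    fix B assume "B \<in> carrier ?H"
    then obtain w where w: "w \<in> words_over (f ` S)"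
      "B = pres_rel (f ` S) (relabel f ` R) `` {w}" by (rule pres_carrierE)
    have "relabel f (relabel ?g w) = w" using w(1)
      by (induction w) (auto simp: f_inv_into_f)
    moreover have "relabel ?g w \<in> words_over S" using relabel_words[OF w(1), of ?g] gf by simp
    ultimately have "B = h (pres_rel S R `` {relabel ?g w})" using h w(2) by simp
    then show "B \<in> h ` carrier ?G"
      using \<open>relabel ?g w \<in> words_over S\<close> pres_class_in_carrier by blast
  qed (use \<open>h \<in> hom ?G ?H\<close> in \<open>auto simp: hom_def\<close>)
  ultimately show ?thesis
    by (auto simp: is_iso_def iso_def bij_betw_def)
qed

lemma raag_relabel_iso:
  assumes f: "inj_on f V" and E: "\<And>e. e \<in> E \<Longrightarrow> e \<subseteq> V"
  shows "raag V E \<cong> raag (f ` V) ((`) f ` E)"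
proof -
  let ?R = "{commutator_word v w | v w. v \<in> V \<and> w \<in> V \<and> {v, w} \<in> E}"
  have edge: "{f v, f w} \<in> (`) f ` E \<longleftrightarrow> {v, w} \<in> E" if "v \<in> V" "w \<in> V" for v w
  proof
    assume "{f v, f w} \<in> (`) f ` E"
    then obtain e where e: "e \<in> E" "f ` {v, w} = f ` e" by auto
    then have "e = {v, w}" using inj_on_image_eq_iff[OF f, of "{v, w}" e] E that by auto
    then show "{v, w} \<in> E" using e by simp
  qed (auto intro: rev_image_eqI)
  have "relabel f ` ?R
      = {commutator_word v w | v w. v \<in> f ` V \<and> w \<in> f ` V \<and> {v, w} \<in> (`) f ` E}"
    (is "_ = ?R'")
  proof (intro equalityI subsetI)
    fix r assume "r \<in> relabel f ` ?R"
    then obtain v w where "v \<in> V" "w \<in> V" "{v, w} \<in> E" "r = relabel f (commutator_word v w)"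
      by blast
    then show "r \<in> ?R'" using edge[of v w]
      by (intro CollectI exI[of _ "f v"] exI[of _ "f w"]) (auto simp: commutator_word_def)
  next
    fix r assume "r \<in> ?R'"
    then obtain v w where "v \<in> V" "w \<in> V" "{f v, f w} \<in> (`) f ` E"
      "r = commutator_word (f v) (f w)"
      by blast
    then show "r \<in> relabel f ` ?R" using edge[of v w]
      by (intro image_eqI[of _ _ "commutator_word v w"]) (auto simp: commutator_word_def)
  qed
  moreover have "?R \<subseteq> words_over V" by (auto simp: commutator_word_def)
  ultimately show ?thesis
    unfolding raag_def using presented_group_relabel_iso[OF f, of ?R] by simp
qed

lemma finite_raag_iso_nat:
  assumes "finite_simplicial_graph V E"
  shows "\<exists>(V' :: nat set) E'. finite_simplicial_graph V' E' \<and> raag V E \<cong> raag V' E'"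
proof -
  obtain f :: "'a \<Rightarrow> nat" where f: "inj_on f V"
    using assms finite_imp_inj_to_nat_seg unfolding finite_simplicial_graph_def by metis
  have "card (f ` e) = 2" if "e \<in> E" for e
    using assms that f card_image[of f e] inj_on_subset[of f V e]
    by (auto simp: finite_simplicial_graph_def)
  then have "finite_simplicial_graph (f ` V) ((`) f ` E)"
    using assms by (auto simp: finite_simplicial_graph_def)
  moreover have "raag V E \<cong> raag (f ` V) ((`) f ` E)"
    using assms f by (intro raag_relabel_iso) (auto simp: finite_simplicial_graph_def)
  ultimately show ?thesis by blast
qed

lemma residually_RAAGI:
  assumes res: "\<And>g. g \<in> carrier G \<Longrightarrow> g \<noteq> \<one>\<^bsub>G\<^esub> \<Longrightarrow>
      \<exists>(V :: 'v set) E \<phi>. finite_simplicial_graph V E \<and> \<phi> \<in> hom G (raag V E)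
        \<and> \<phi> g \<noteq> \<one>\<^bsub>raag V E\<^esub>"
  shows "residually_RAAG G"
  unfolding residually_RAAG_def
proof (intro ballI impI)
  fix g assume g: "g \<in> carrier G" "g \<noteq> \<one>\<^bsub>G\<^esub>"
  from res[OF g] obtain V :: "'v set" and E \<phi> where V: "finite_simplicial_graph V E"
    and \<phi>: "\<phi> \<in> hom G (raag V E)" "\<phi> g \<noteq> \<one>\<^bsub>raag V E\<^esub>" by (elim exE conjE)
  obtain V' :: "nat set" and E' h where V': "finite_simplicial_graph V' E'"
    and h: "h \<in> iso (raag V E) (raag V' E')"
    using finite_raag_iso_nat[OF V] by (auto simp: is_iso_def)
  have hh: "h \<in> hom (raag V E) (raag V' E')" and inj: "inj_on h (carrier (raag V E))"
    using h by (auto simp: iso_def bij_betw_def)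
  have one: "h \<one>\<^bsub>raag V E\<^esub> = \<one>\<^bsub>raag V' E'\<^esub>"
    using hom_one[OF hh group_raag group_raag] .
  have "\<phi> g \<in> carrier (raag V E)" using \<phi>(1) g(1) by (auto simp: hom_def)
  moreover have "\<one>\<^bsub>raag V E\<^esub> \<in> carrier (raag V E)"
    by (intro monoid.one_closed group.is_monoid group_raag)
  ultimately have "h (\<phi> g) \<noteq> \<one>\<^bsub>raag V' E'\<^esub>"
    using inj_onD[OF inj, of "\<phi> g" "\<one>\<^bsub>raag V E\<^esub>"] \<phi>(2) one by auto
  moreover have "h \<circ> \<phi> \<in> hom G (raag V' E')" using \<phi>(1) hh by (rule hom_compose)
  ultimately show "\<exists>(V :: nat set) E \<phi>. finite_simplicial_graph V E \<and> \<phi> \<in> hom G (raag V E)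
        \<and> \<phi> g \<noteq> \<one>\<^bsub>raag V E\<^esub>"
    using V' by (intro exI[of _ V'] exI[of _ E'] exI[of _ "h \<circ> \<phi>"] conjI) simp_all
qed

section \<open>Piecewise-linear homeomorphisms of the real line\<close>

definition piecewise_linear :: "(real \<Rightarrow> real) \<Rightarrow> bool" where
  "piecewise_linear f \<longleftrightarrow>
    (\<exists>B. closed B \<and> discrete B \<and>
      (\<forall>C\<in>components (- B). \<exists>a b. \<forall>x\<in>C. f x = a * x + b))"

definition PL_plus :: "(real \<Rightarrow> real) monoid" where
  "PL_plus =
    \<lparr>carrier = {f. (\<exists>g. homeomorphism UNIV UNIV f g) \<and> strict_mono f \<and> piecewise_linear f},
     monoid.mult = (\<circ>),
     one = id\<rparr>"

lemma closed_discrete_iff_no_limpt: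
  fixes B :: "'a::metric_space set"
  shows "closed B \<and> discrete B \<longleftrightarrow> (\<forall>x. \<not> x islimpt B)"
  unfolding closed_limpt discrete_def isolated_in_islimpt_iff by blast

lemma closed_discrete_homeomorphic_image:
  fixes f :: "'a::metric_space \<Rightarrow> 'b::metric_space"
  assumes h: "homeomorphism UNIV UNIV f g" and B: "closed B" "discrete B"
  shows "closed (f ` B) \<and> discrete (f ` B)"
  unfolding closed_discrete_iff_no_limpt
proof (intro allI notI)
  fix y assume y: "y islimpt f ` B"
  have "isCont g y" "inj g"
    using h by (auto simp: homeomorphism_def continuous_on_eq_continuous_at intro: inj_on_inverseI)
  then have "g y islimpt g ` f ` B"
    by (intro islimpt_isCont_image[OF y]) (auto simp: eventually_at_filter inj_eq)
  moreover have "g ` f ` B = B" using h by (auto simp: homeomorphism_def image_image)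
  ultimately show False using B closed_discrete_iff_no_limpt by metis
qed

lemma piecewise_linear_subset:
  assumes "\<forall>C\<in>components (- B). \<exists>a b. \<forall>x\<in>C. f x = a * x + (b :: real)"
    and "connected C" "C \<noteq> {}" "C \<subseteq> - B"
  shows "\<exists>a b. \<forall>x\<in>C. f x = a * x + b"
proof -
  have "- B \<noteq> {}" using assms(3,4) by auto
  with assms(2-4) obtain D where "D \<in> components (- B)" "C \<subseteq> D"
    using exists_component_superset by metis
  with assms(1) show ?thesis by blast
qed

lemma PL_plus_comp:
  assumes "f \<in> carrier PL_plus" "g \<in> carrier PL_plus"
  shows "f \<circ> g \<in> carrier PL_plus"
proof -
  obtain f' g' where hf: "homeomorphism UNIV UNIV f f'" and hg: "homeomorphism UNIV UNIV g g'"
    using assms by (auto simp: PL_plus_def)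
  obtain B where B: "closed B" "discrete B"
    "\<forall>C\<in>components (- B). \<exists>a b. \<forall>x\<in>C. f x = a * x + b"
    using assms(1) by (auto simp: PL_plus_def piecewise_linear_def)
  obtain D where D: "closed D" "discrete D"
    "\<forall>C\<in>components (- D). \<exists>a b. \<forall>x\<in>C. g x = a * x + b"
    using assms(2) by (auto simp: PL_plus_def piecewise_linear_def)
  have "closed (g' ` B) \<and> discrete (g' ` B)"
    using closed_discrete_homeomorphic_image[OF _ B(1,2)] hg homeomorphism_symD by blast
  then have "closed (D \<union> g' ` B) \<and> discrete (D \<union> g' ` B)"
    using D(1,2) unfolding closed_discrete_iff_no_limpt islimpt_Un
    by (metis closed_discrete_iff_no_limpt)
  moreover have "\<exists>a b. \<forall>x\<in>C. (f \<circ> g) x = a * x + b" if C: "C \<in> components (- (D \<union> g' ` B))" for C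
  proof -
    have conn: "connected C" and ne: "C \<noteq> {}" and sub: "C \<subseteq> - (D \<union> g' ` B)"
      using C in_components_connected in_components_nonempty in_components_subset by blast+
    obtain a b where ab: "\<forall>x\<in>C. g x = a * x + b"
      using piecewise_linear_subset[OF D(3) conn ne] sub by auto
    have "connected (g ` C)"
      using hg conn by (meson connected_continuous_image continuous_on_subset homeomorphism_def
          subset_UNIV)
    moreover have "g ` C \<subseteq> - B"
    proof (intro subsetI ComplI; elim imageE)
      fix y x assume "y \<in> B" "y = g x" "x \<in> C"
      moreover then have "x = g' y" using hg by (simp add: homeomorphism_def)
      ultimately show False using sub by blast
    qed
    ultimately obtain c d where cd: "\<forall>x\<in>g ` C. f x = c * x + d"
      using piecewise_linear_subset[OF B(3), of "g ` C"] ne by auto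
    have "\<forall>x\<in>C. (f \<circ> g) x = (c * a) * x + (c * b + d)"
      using ab cd by (auto simp: algebra_simps)
    then show ?thesis by blast
  qed
  ultimately have "piecewise_linear (f \<circ> g)"
    unfolding piecewise_linear_def by blast
  moreover have "strict_mono (f \<circ> g)"
    using assms by (auto simp: PL_plus_def strict_mono_def)
  moreover have "homeomorphism UNIV UNIV (f \<circ> g) (g' \<circ> f')"
    using homeomorphism_compose[OF hg hf] .
  ultimately show ?thesis by (auto simp: PL_plus_def)
qed

lemma PL_plus_inverse:
  assumes f: "f \<in> carrier PL_plus" and h: "homeomorphism UNIV UNIV f g"
  shows "g \<in> carrier PL_plus"
proof -
  have mono: "strict_mono f" using f by (simp add: PL_plus_def)
  have fg: "f (g x) = x" and gf: "g (f x) = x" for x using h by (auto simp: homeomorphism_def)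
  obtain B where B: "closed B" "discrete B"
    "\<forall>C\<in>components (- B). \<exists>a b. \<forall>x\<in>C. f x = a * x + b"
    using f by (auto simp: PL_plus_def piecewise_linear_def)
  have "\<exists>a b. \<forall>x\<in>C. g x = a * x + b" if C: "C \<in> components (- f ` B)" for C
  proof -
    have conn: "connected C" and ne: "C \<noteq> {}" and sub: "C \<subseteq> - f ` B"
      using C in_components_connected in_components_nonempty in_components_subset by blast+
    have "connected (g ` C)"
      using h conn by (meson connected_continuous_image continuous_on_subset homeomorphism_def
          subset_UNIV)
    moreover have "g ` C \<subseteq> - B"
    proof (intro subsetI ComplI; elim imageE)
      fix y x assume "y \<in> B" "y = g x" "x \<in> C"
      then show False using sub fg[of x] by (metis ComplD imageI subsetD)
    qed
    ultimately obtain a b where ab: "\<forall>x\<in>g ` C. f x = a * x + b"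
      using piecewise_linear_subset[OF B(3), of "g ` C"] ne by auto
    then have eq: "y = a * g y + b" if "y \<in> C" for y using that fg by (metis imageI)
    show ?thesis
    proof (cases "a = 0")
      case True
      then have "\<forall>y\<in>C. g y = 0 * y + g b" using eq by auto
      then show ?thesis by blast
    next
      case False
      have "g y = (1 / a) * y + (- b / a)" if "y \<in> C" for y
        using eq[OF that] False by (simp add: field_simps)
      then show ?thesis by blast
    qed
  qed
  then have "piecewise_linear g"
    using closed_discrete_homeomorphic_image[OF h B(1,2)] unfolding piecewise_linear_def by blast
  moreover have "strict_mono g"
    by (rule strict_monoI) (metis fg mono strict_mono_less)
  moreover have "homeomorphism UNIV UNIV g f" using h by (rule homeomorphism_symD)
  ultimately show ?thesis by (auto simp: PL_plus_def)
qed

lemma group_PL_plus: "group PL_plus"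
proof (rule groupI)
  have "\<forall>x. id x = 1 * x + (0 :: real)" by simp
  then have "piecewise_linear id"
    unfolding piecewise_linear_def by (metis closed_empty discrete_empty)
  moreover have "homeomorphism UNIV UNIV (id :: real \<Rightarrow> real) id"
    by (auto simp: homeomorphism_def)
  ultimately show "\<one>\<^bsub>PL_plus\<^esub> \<in> carrier PL_plus"
    by (auto simp: PL_plus_def strict_mono_def)
next
  fix f g assume "f \<in> carrier PL_plus" "g \<in> carrier PL_plus"
  then show "f \<otimes>\<^bsub>PL_plus\<^esub> g \<in> carrier PL_plus"
    using PL_plus_comp by (simp add: PL_plus_def)
next
  fix f assume f: "f \<in> carrier PL_plus"
  then obtain g where g: "homeomorphism UNIV UNIV f g" by (auto simp: PL_plus_def)
  then have "g \<otimes>\<^bsub>PL_plus\<^esub> f = \<one>\<^bsub>PL_plus\<^esub>"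
    by (auto simp: PL_plus_def homeomorphism_def fun_eq_iff)
  then show "\<exists>g\<in>carrier PL_plus. g \<otimes>\<^bsub>PL_plus\<^esub> f = \<one>\<^bsub>PL_plus\<^esub>"
    using PL_plus_inverse[OF f g] by blast
qed (simp_all add: PL_plus_def comp_assoc)

end

theory Submission
  imports Defs "HOL-Algebra.Coset"
begin

text \<open>It suffices to find, for every nontrivial \<open>a\<close> in a right-angled Artin group, an action by PL
  homeomorphisms of compact support in which \<open>a\<close> moves a point: the actions obtained from countably
  many group elements are rescaled to act on the pairwise disjoint intervals \<open>[n, n + 1]\<close>.

  Write \<open>a\<close> as a reduced word, read it in the order in which its letters act, and select from it a
  chain of letters, each being the first one after its predecessor not to commute with it. The
  \<open>i\<close>-th letter of the chain gets a bump on \<open>[2i, 2i + 3]\<close>. Only consecutive intervals overlap, and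
  their letters do not commute, so commuting generators have disjoint supports; and the chain carries
  the point \<open>1/2\<close> from one interval to the next.\<close>

section \<open>Elements of \<open>PL_plus\<close>\<close>

interpretation PL: group PL_plus
  by (rule group_PL_plus)

lemma mult_PL_plus [simp]: "f \<otimes>\<^bsub>PL_plus\<^esub> g = f \<circ> g"
  by (simp add: PL_plus_def)

lemma one_PL_plus [simp]: "\<one>\<^bsub>PL_plus\<^esub> = id"
  by (simp add: PL_plus_def)

lemma PL_plus_strict_mono: "f \<in> carrier PL_plus \<Longrightarrow> strict_mono f"
  by (simp add: PL_plus_def)

text \<open>A monotone surjection of the line cannot jump, so it is continuous, and the same holds
  for its inverse; the homeomorphism condition thus follows from order and surjectivity.\<close>

lemma PL_plusI:
  assumes mono: "strict_mono f" and surj: "surj f" and "piecewise_linear f"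
  shows "f \<in> carrier PL_plus"
proof -
  have "bij f" using strict_mono_imp_inj_on[OF mono] surj by (simp add: bij_def)
  define g where "g = inv_into UNIV f"
  have fg: "f (g x) = x" and gf: "g (f x) = x" for x
    using \<open>bij f\<close> by (simp_all add: g_def bij_def surj_f_inv_f)
  have "mono g"
    by (rule monoI) (metis fg mono strict_mono_less_eq)
  have "surj g" using gf by (rule surjI)
  have "continuous_on UNIV f"
    using surj mono by (intro continuous_onI_mono) (auto simp: strict_mono_less_eq)
  moreover have "continuous_on UNIV g"
    using \<open>mono g\<close> \<open>surj g\<close> by (intro continuous_onI_mono) (auto dest: monoD)
  ultimately have "homeomorphism UNIV UNIV f g"
    using surj \<open>surj g\<close> by (auto simp: homeomorphism_def fg gf)
  with assms show ?thesis by (auto simp: PL_plus_def)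
qed

lemma PL_plus_inv_apply [simp]:
  assumes "f \<in> carrier PL_plus"
  shows "f ((inv\<^bsub>PL_plus\<^esub> f) x) = x" and "(inv\<^bsub>PL_plus\<^esub> f) (f x) = x"
  using PL.r_inv[OF assms] PL.l_inv[OF assms] by (auto simp: fun_eq_iff)

lemma connected_avoids:
  fixes C :: "real set"
  assumes "connected C" "p \<notin> C"
  shows "C \<subseteq> {..<p} \<or> C \<subseteq> {p<..}"
proof (rule ccontr)
  assume "\<not> ?thesis"
  then obtain x y where "x \<in> C" "y \<in> C" "p \<le> x" "y \<le> p"
    by (auto simp: subset_eq not_less)
  then have "p \<in> C" using connected_contains_Icc[OF assms(1), of y x] by auto
  with assms(2) show False by simp
qed

lemma affine_PL_plus:
  assumes "a > 0"
  shows "(\<lambda>x. a * x + b) \<in> carrier PL_plus"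
proof (rule PL_plusI)
  show "strict_mono (\<lambda>x. a * x + b)" using assms by (auto simp: strict_mono_def)
  show "surj (\<lambda>x. a * x + b)"
    using assms by (intro surjI[of _ "\<lambda>y. (y - b) / a"]) simp
  show "piecewise_linear (\<lambda>x. a * x + b)"
    unfolding piecewise_linear_def by (rule exI[of _ "{}"]) auto
qed

text \<open>On \<open>[t, t + 3]\<close> the graph consists of a segment of slope \<open>5\<close> and one of slope \<open>1/5\<close>,
  meeting over \<open>t + 1/2\<close>; elsewhere this is the identity.\<close>

definition bump :: "real \<Rightarrow> real \<Rightarrow> real" where
  "bump t x = max x (min (5 * x - 4 * t) ((x + 4 * t + 12) / 5))"

lemma bump_PL_plus: "bump t \<in> carrier PL_plus"
proof (rule PL_plusI)
  show "strict_mono (bump t)"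
    by (auto simp: strict_mono_def bump_def max_def min_def field_simps)
  \<comment> \<open>The inverse of a maximum of increasing maps is the minimum of their inverses,
    and dually; each affine piece is inverted separately.\<close>
  have "bump t (min y (max ((y + 4 * t) / 5) (5 * y - 4 * t - 12))) = y" for y
    by (auto simp: bump_def max_def min_def field_simps)
  then show "surj (bump t)" by (rule surjI)
  let ?B = "{t, t + 1/2, t + 3}"
  have "\<exists>a b. \<forall>x\<in>C. bump t x = a * x + b" if C: "C \<in> components (- ?B)" for C
  proof -
    have conn: "connected C" and sub: "C \<subseteq> - ?B"
      using C in_components_connected in_components_subset by blast+
    have "C \<subseteq> {..<p} \<or> C \<subseteq> {p<..}" if "p \<in> ?B" for p
      using connected_avoids[OF conn, of p] sub that by blast
    then have sides: "C \<subseteq> {..<t} \<or> C \<subseteq> {t<..}" "C \<subseteq> {..<t + 1/2} \<or> C \<subseteq> {t + 1/2<..}"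
      "C \<subseteq> {..<t + 3} \<or> C \<subseteq> {t + 3<..}"
      by simp_all
    then consider "C \<subseteq> {..<t}" | "C \<subseteq> {t<..<t + 1/2}" | "C \<subseteq> {t + 1/2<..<t + 3}" | "C \<subseteq> {t + 3<..}"
      by fastforce
    then show ?thesis
    proof cases
      case 1
      then have "\<forall>x\<in>C. bump t x = 1 * x + 0"
        by (auto simp: bump_def max_def min_def field_simps dest: subsetD)
      then show ?thesis by blast
    next
      case 2
      then have "\<forall>x\<in>C. bump t x = 5 * x + (- 4 * t)"
        by (auto simp: bump_def max_def min_def field_simps dest: subsetD)
      then show ?thesis by blast
    next
      case 3
      then have "\<forall>x\<in>C. bump t x = 1/5 * x + (4 * t + 12) / 5"
        by (auto simp: bump_def max_def min_def field_simps dest: subsetD)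
      then show ?thesis by blast
    next
      case 4
      then have "\<forall>x\<in>C. bump t x = 1 * x + 0"
        by (auto simp: bump_def max_def min_def field_simps dest: subsetD)
      then show ?thesis by blast
    qed
  qed
  moreover have "closed ?B \<and> discrete ?B"
    unfolding closed_discrete_iff_no_limpt by (simp add: islimpt_finite)
  ultimately show "piecewise_linear (bump t)"
    unfolding piecewise_linear_def by blast
qed

lemma bump_fixes: "x \<le> t \<or> t + 3 \<le> x \<Longrightarrow> bump t x = x"
  by (auto simp: bump_def max_def min_def field_simps)

text \<open>The breakpoint \<open>t + 1/2\<close> goes to \<open>t + 5/2\<close>, and
  \<open>t + 3\<close> is fixed. With bumps spaced by 2, the image interval starts exactly at the
  middle breakpoint of the next bump.\<close>

lemma bump_expands:
  "t + 1/2 \<le> x \<Longrightarrow> x \<le> t + 3 \<Longrightarrow> t + 5/2 \<le> bump t x \<and> bump t x \<le> t + 3"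
  by (auto simp: bump_def max_def min_def field_simps)

text \<open>Both maps fix \<open>b\<close>, so by monotonicity they preserve the two half-lines at
  \<open>b\<close>, and on each half-line one of them is the identity.\<close>

lemma disjoint_supports_commute:
  fixes f g :: "real \<Rightarrow> real"
  assumes "strict_mono f" "strict_mono g"
    and f: "\<And>x. b \<le> x \<Longrightarrow> f x = x" and g: "\<And>x. x \<le> b \<Longrightarrow> g x = x"
  shows "f \<circ> g = g \<circ> f"
proof
  fix x
  show "(f \<circ> g) x = (g \<circ> f) x"
  proof (cases "x \<le> b")
    case True
    then have "f x \<le> f b" using assms(1) by (simp add: strict_mono_less_eq)
    then show ?thesis using True f g by simp
  next
    case False
    then have "g b \<le> g x" using assms(2) by (simp add: strict_mono_less_eq)
    then show ?thesis using False f g by simp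
  qed
qed

section \<open>Words and homomorphisms\<close>

definition letter :: "('g, 'm) monoid_scheme \<Rightarrow> ('v \<Rightarrow> 'g) \<Rightarrow> 'v \<times> bool \<Rightarrow> 'g" where
  "letter H F l = (if snd l then F (fst l) else inv\<^bsub>H\<^esub> F (fst l))"

definition word_val :: "('g, 'm) monoid_scheme \<Rightarrow> ('v \<Rightarrow> 'g) \<Rightarrow> 'v word \<Rightarrow> 'g" where
  "word_val H F u = foldr (\<lambda>l a. letter H F l \<otimes>\<^bsub>H\<^esub> a) u \<one>\<^bsub>H\<^esub>"

lemma word_val_simps [simp]:
  "word_val H F [] = \<one>\<^bsub>H\<^esub>"
  "word_val H F (l # u) = letter H F l \<otimes>\<^bsub>H\<^esub> word_val H F u"
  by (simp_all add: word_val_def)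

context group
begin

context
  fixes F :: "'v \<Rightarrow> 'a" and S :: "'v set"
  assumes F: "\<And>v. v \<in> S \<Longrightarrow> F v \<in> carrier G"
begin

lemma letter_closed: "fst l \<in> S \<Longrightarrow> letter G F l \<in> carrier G"
  by (simp add: letter_def F)

lemma word_val_closed: "u \<in> words_over S \<Longrightarrow> word_val G F u \<in> carrier G"
  by (induction u) (auto simp: letter_closed)

lemma word_val_append:
  "u \<in> words_over S \<Longrightarrow> v \<in> words_over S \<Longrightarrow>
    word_val G F (u @ v) = word_val G F u \<otimes> word_val G F v"
  by (induction u) (auto simp: letter_closed word_val_closed m_assoc)

lemma word_val_cong:
  assumes "\<And>r. r \<in> R \<Longrightarrow> r \<in> words_over S \<Longrightarrow> word_val G F r = \<one>"
    and "pres_cong S R u v"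
  shows "word_val G F u = word_val G F v"
  using assms(2)
proof induction
  case (append u u' v v')
  then show ?case using pres_cong_words[of S R] by (simp add: word_val_append)
qed (auto simp: letter_def F assms(1))

text \<open>The universal property of a presentation (von Dyck).\<close>

lemma presented_group_hom:
  assumes "\<And>r. r \<in> R \<Longrightarrow> r \<in> words_over S \<Longrightarrow> word_val G F r = \<one>"
  shows "\<exists>\<theta>\<in>hom (presented_group S R) G.
    \<forall>u\<in>words_over S. \<theta> (pres_rel S R `` {u}) = word_val G F u"
proof -
  \<comment> \<open>Any representative will do: by \<open>word_val_cong\<close> the value depends
    only on the class.\<close>
  define \<theta> where "\<theta> A = word_val G F (SOME u. u \<in> A)" for A
  have \<theta>: "\<theta> (pres_rel S R `` {u}) = word_val G F u" if "u \<in> words_over S" for u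
  proof -
    have "u \<in> pres_rel S R `` {u}"
      using that by (auto simp: pres_rel_def intro: pres_cong.refl)
    then have "pres_cong S R u (SOME v. v \<in> pres_rel S R `` {u})"
      using someI[of "\<lambda>v. v \<in> pres_rel S R `` {u}"] by (auto simp: pres_rel_def)
    then show ?thesis unfolding \<theta>_def using word_val_cong[OF assms] by metis
  qed
  moreover have "\<theta> \<in> hom (presented_group S R) G"
    by (rule homI)
      (auto elim!: pres_carrierE simp: \<theta> pres_mult_class word_val_closed word_val_append)
  ultimately show ?thesis by blast
qed

end

lemma commute_inv:
  assumes "x \<in> carrier G" "y \<in> carrier G" "x \<otimes> y = y \<otimes> x"
  shows "inv x \<otimes> y = y \<otimes> inv x"
proof -
  have "inv x \<otimes> y = inv x \<otimes> (y \<otimes> x) \<otimes> inv x" using assms(1,2) by (simp add: m_assoc)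
  also have "\<dots> = y \<otimes> inv x"
    unfolding assms(3)[symmetric] using assms(1,2) by (simp add: m_assoc[symmetric])
  finally show ?thesis .
qed

text \<open>The right-nested bracketing is the one produced by evaluating
  \<open>commutator_word\<close> letter by letter.\<close>

lemma commutator_one_iff:
  assumes "x \<in> carrier G" "y \<in> carrier G"
  shows "x \<otimes> (y \<otimes> (inv x \<otimes> inv y)) = \<one> \<longleftrightarrow> x \<otimes> y = y \<otimes> x"
proof -
  have "x \<otimes> (y \<otimes> (inv x \<otimes> inv y)) = (x \<otimes> y) \<otimes> inv (y \<otimes> x)"
    using assms by (simp add: inv_mult_group m_assoc)
  then show ?thesis using assms by (metis inv_equality inv_inv inv_closed m_closed r_inv)
qed

end

section \<open>Reduced words in right-angled Artin groups\<close>

text \<open>Failure of two generators to commute; equality is excluded because a generator commutes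
  with its own powers.\<close>

definition dep :: "'v set set \<Rightarrow> 'v \<Rightarrow> 'v \<Rightarrow> bool" where
  "dep E v w \<longleftrightarrow> v \<noteq> w \<and> {v, w} \<notin> E"

text \<open>No letter can be shuffled past commuting letters up to a later inverse of itself and
  cancelled there.\<close>

definition raag_reduced :: "'v set set \<Rightarrow> 'v word \<Rightarrow> bool" where
  "raag_reduced E u \<longleftrightarrow>
    (\<forall>p x b q r. u = p @ [(x, b)] @ q @ [(x, \<not> b)] @ r \<longrightarrow> (\<exists>l\<in>set q. dep E x (fst l)))"

lemma raag_reduced_appendD: "raag_reduced E (u @ v) \<Longrightarrow> raag_reduced E v"
  unfolding raag_reduced_def by (metis append_assoc)

text \<open>The condition is symmetric in the two opposite letters. Reversal is needed because the
  last letter of a word acts first.\<close>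

lemma raag_reduced_rev:
  assumes "raag_reduced E u"
  shows "raag_reduced E (rev u)"
  unfolding raag_reduced_def
proof (intro allI impI)
  fix p x b q r assume "rev u = p @ [(x, b)] @ q @ [(x, \<not> b)] @ r"
  then have "u = rev r @ [(x, \<not> b)] @ rev q @ [(x, \<not> \<not> b)] @ rev p"
    by (metis append_assoc rev_append rev_rev_ident rev_singleton_conv not_not)
  then have "\<exists>l\<in>set (rev q). dep E x (fst l)"
    using assms unfolding raag_reduced_def by blast
  then show "\<exists>l\<in>set q. dep E x (fst l)" by simp
qed

text \<open>A shortest word representing \<open>a\<close> is reduced.\<close>

lemma raag_reduced_representative:
  assumes "a \<in> carrier (raag V E)"
  obtains u where "u \<in> words_over V" "raag_reduced E u"
    "a = pres_rel V {commutator_word v w | v w. v \<in> V \<and> w \<in> V \<and> {v, w} \<in> E} `` {u}"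
proof -
  define R where "R = {commutator_word v w | v w. v \<in> V \<and> w \<in> V \<and> {v, w} \<in> E}"
  define cl where "cl u = pres_rel V R `` {u}" for u
  have raag: "raag V E = presented_group V R" by (simp add: raag_def R_def)
  interpret A: group "raag V E" by (rule group_raag)
  have cl_append: "cl (u @ v) = cl u \<otimes>\<^bsub>raag V E\<^esub> cl v"
    if "u \<in> words_over V" "v \<in> words_over V" for u v
    using that by (simp add: cl_def raag pres_mult_class)
  have cl_closed: "cl u \<in> carrier (raag V E)" if "u \<in> words_over V" for u
    using that by (simp add: cl_def raag pres_class_in_carrier)
  have cl_Nil: "cl [] = \<one>\<^bsub>raag V E\<^esub>" by (simp add: cl_def raag pres_one)
  have cl_cancel: "cl [(x, b)] \<otimes>\<^bsub>raag V E\<^esub> cl [(x, \<not> b)] = \<one>\<^bsub>raag V E\<^esub>" if "x \<in> V" for x b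
    using pres_cong.cancel[OF that, of R b] that
    by (simp add: cl_append[symmetric] cl_Nil[symmetric]) (simp add: cl_def pres_class_eq_iff)
  have cl_inv: "cl [(x, \<not> b)] = inv\<^bsub>raag V E\<^esub> cl [(x, b)]" if "x \<in> V" for x b
    using cl_cancel[OF that, of "\<not> b"] A.inv_equality cl_closed that by simp
  have comm: "cl [(x, b)] \<otimes>\<^bsub>raag V E\<^esub> cl [(y, c)] = cl [(y, c)] \<otimes>\<^bsub>raag V E\<^esub> cl [(x, b)]"
    if xy: "x \<in> V" "y \<in> V" "\<not> dep E x y" for x b y c
  \<comment> \<open>For equal vertices either the letters coincide or both products are
    trivial.\<close>
  proof (cases "x = y")
    case True
    then show ?thesis
      using cl_cancel[OF xy(1), of True] cl_cancel[OF xy(1), of False] by (cases b; cases c) auto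
  next
    case False
    with xy have "commutator_word x y \<in> R" unfolding R_def dep_def by blast
    then have "pres_cong V R (commutator_word x y) []"
      using xy by (intro pres_cong.relator) (auto simp: commutator_word_def)
    then have "cl (commutator_word x y) = \<one>\<^bsub>raag V E\<^esub>"
      using xy by (simp add: cl_Nil[symmetric] cl_def pres_class_eq_iff commutator_word_def)
    moreover have "commutator_word x y = [(x, True)] @ [(y, True)] @ [(x, False)] @ [(y, False)]"
      by (simp add: commutator_word_def)
    ultimately have "cl [(x, True)] \<otimes>\<^bsub>raag V E\<^esub> (cl [(y, True)] \<otimes>\<^bsub>raag V E\<^esub>
        (cl [(x, False)] \<otimes>\<^bsub>raag V E\<^esub> cl [(y, False)])) = \<one>\<^bsub>raag V E\<^esub>"
      using xy by (simp add: cl_append del: append.simps)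
    then have c: "cl [(x, True)] \<otimes>\<^bsub>raag V E\<^esub> cl [(y, True)]
        = cl [(y, True)] \<otimes>\<^bsub>raag V E\<^esub> cl [(x, True)]"
      using cl_inv[OF xy(1), of True] cl_inv[OF xy(2), of True] xy
      by (simp add: A.commutator_one_iff cl_closed)
    \<comment> \<open>The relator covers positive letters only; the signs are extended by
      \<open>commute_inv\<close>, first for \<open>x\<close> and then for \<open>y\<close>.\<close>
    have c': "cl [(x, b)] \<otimes>\<^bsub>raag V E\<^esub> cl [(y, True)]
        = cl [(y, True)] \<otimes>\<^bsub>raag V E\<^esub> cl [(x, b)]"
      using c A.commute_inv[OF _ _ c] cl_inv[OF xy(1), of True] xy
      by (cases b) (simp_all add: cl_closed)
    show ?thesis
      using c' A.commute_inv[OF _ _ c'[symmetric]] cl_inv[OF xy(2), of True] xy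
      by (cases c) (simp_all add: cl_closed)
  qed
  have comm_word: "cl [(x, b)] \<otimes>\<^bsub>raag V E\<^esub> cl q = cl q \<otimes>\<^bsub>raag V E\<^esub> cl [(x, b)]"
    if "x \<in> V" "q \<in> words_over V" "\<forall>l\<in>set q. \<not> dep E x (fst l)" for x b q
    using that(2,3)
  proof (induction q)
    case Nil
    then show ?case using that(1) by (simp add: cl_Nil cl_closed)
  next
    case (Cons l q)
    obtain y c where l: "l = (y, c)" by (cases l)
    have yq: "y \<in> V" "q \<in> words_over V" using Cons.prems l by auto
    have closed: "cl [(x, b)] \<in> carrier (raag V E)" "cl [l] \<in> carrier (raag V E)"
      "cl q \<in> carrier (raag V E)"
      using cl_closed that(1) yq l by simp_all
    have lq: "cl (l # q) = cl [l] \<otimes>\<^bsub>raag V E\<^esub> cl q"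
      using cl_append[of "[l]" q] yq l by simp
    have xl: "cl [(x, b)] \<otimes>\<^bsub>raag V E\<^esub> cl [l] = cl [l] \<otimes>\<^bsub>raag V E\<^esub> cl [(x, b)]"
      unfolding l using Cons.prems l by (intro comm that(1) yq(1)) simp
    have xq: "cl [(x, b)] \<otimes>\<^bsub>raag V E\<^esub> cl q = cl q \<otimes>\<^bsub>raag V E\<^esub> cl [(x, b)]"
      using Cons yq by simp
    show ?case
      unfolding lq using closed by (simp add: A.m_assoc xq[symmetric]) (simp add: A.m_assoc[symmetric] xl)
  qed
  obtain u0 where u0: "u0 \<in> words_over V" "a = cl u0"
    using assms unfolding raag cl_def by (rule pres_carrierE)
  define u where "u = arg_min length (\<lambda>u. u \<in> words_over V \<and> a = cl u)"
  have u: "u \<in> words_over V" "a = cl u"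
    and min: "\<And>v. v \<in> words_over V \<Longrightarrow> a = cl v \<Longrightarrow> length u \<le> length v"
    using arg_min_nat_lemma[of "\<lambda>u. u \<in> words_over V \<and> a = cl u" u0 length] u0
    unfolding u_def by auto
  have "raag_reduced E u"
    unfolding raag_reduced_def
  proof (intro allI impI, rule ccontr)
    fix p x b q r
    assume eq: "u = p @ [(x, b)] @ q @ [(x, \<not> b)] @ r" and nd: "\<not> (\<exists>l\<in>set q. dep E x (fst l))"
    have w: "p \<in> words_over V" "q \<in> words_over V" "r \<in> words_over V" "x \<in> V"
      using u(1) eq by auto
    \<comment> \<open>Sliding the letter through \<open>q\<close> makes it meet its inverse, so
      \<open>p @ q @ r\<close> also represents \<open>a\<close> and is shorter by two.\<close>
    have "cl [(x, b)] \<otimes>\<^bsub>raag V E\<^esub> (cl q \<otimes>\<^bsub>raag V E\<^esub> (cl [(x, \<not> b)] \<otimes>\<^bsub>raag V E\<^esub> cl r))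
        = (cl [(x, b)] \<otimes>\<^bsub>raag V E\<^esub> cl q) \<otimes>\<^bsub>raag V E\<^esub> (cl [(x, \<not> b)] \<otimes>\<^bsub>raag V E\<^esub> cl r)"
      using w by (simp add: A.m_assoc cl_closed)
    also have "\<dots> = cl q \<otimes>\<^bsub>raag V E\<^esub>
        ((cl [(x, b)] \<otimes>\<^bsub>raag V E\<^esub> cl [(x, \<not> b)]) \<otimes>\<^bsub>raag V E\<^esub> cl r)"
      using w nd by (simp add: comm_word A.m_assoc cl_closed)
    also have "\<dots> = cl q \<otimes>\<^bsub>raag V E\<^esub> cl r"
      using w by (simp add: cl_cancel cl_closed)
    finally have "cl u = cl (p @ q @ r)"
      unfolding eq using w by (simp add: cl_append del: append.simps)
    then have "length u \<le> length (p @ q @ r)" using min[of "p @ q @ r"] u(2) w by simp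
    then show False by (simp add: eq)
  qed
  with u show ?thesis using that by (simp add: cl_def R_def)
qed

section \<open>Moving a point along a chain of letters\<close>

function chain :: "'v set set \<Rightarrow> 'v word \<Rightarrow> 'v word" where
  "chain E [] = []"
| "chain E (s # t) = s # chain E (dropWhile (\<lambda>l. \<not> dep E (fst s) (fst l)) t)"
  by pat_completeness auto
termination
  by (relation "Wellfounded.measure (\<lambda>(E, t). length t)") (auto simp: le_imp_less_Suc length_dropWhile_le)

text \<open>\<open>dropWhile\<close> stops at the first letter dependent on \<open>s\<close>, and
  this letter becomes the next entry.\<close>

lemma chain_dep:
  "Suc i < length (chain E t) \<Longrightarrow> dep E (fst (chain E t ! i)) (fst (chain E t ! Suc i))"
proof (induction E t arbitrary: i rule: chain.induct)
  case (2 E s t)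
  let ?t = "dropWhile (\<lambda>l. \<not> dep E (fst s) (fst l)) t"
  show ?case
  proof (cases i)
    case 0
    have ne: "?t \<noteq> []" using 2(2) 0 by (intro notI) simp
    then have "chain E ?t ! 0 = hd ?t" by (cases ?t) auto
    moreover have "dep E (fst s) (fst (hd ?t))" using hd_dropWhile[OF ne] by simp
    ultimately show ?thesis using 0 by simp
  next
    case (Suc j)
    then show ?thesis using 2 by simp
  qed
qed simp

text \<open>The sign is chosen so that the \<open>i\<close>-th letter of the chain moves points of \<open>[2i, 2i + 3]\<close> to the
  right, whichever of a generator and its inverse it is.\<close>

definition chain_bump :: "'v word \<Rightarrow> nat \<Rightarrow> real \<Rightarrow> real" where
  "chain_bump c i =
    (if snd (c ! i) then bump (2 * real i) else inv\<^bsub>PL_plus\<^esub> bump (2 * real i))"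

text \<open>The action of a vertex \<open>v\<close>: the product of the bumps of all its occurrences
  in the chain. For an actual chain these have disjoint supports, since consecutive entries have
  distinct vertices, so the order of the factors is immaterial.\<close>

fun chain_prod :: "'v word \<Rightarrow> nat \<Rightarrow> 'v \<Rightarrow> real \<Rightarrow> real" where
  "chain_prod c 0 v = id"
| "chain_prod c (Suc k) v = (if fst (c ! k) = v then chain_prod c k v \<circ> chain_bump c k
     else chain_prod c k v)"

lemma chain_bump_PL_plus: "chain_bump c i \<in> carrier PL_plus"
  by (simp add: chain_bump_def bump_PL_plus)

lemma chain_bump_fixes:
  assumes "x \<le> 2 * real i \<or> 2 * real i + 3 \<le> x"
  shows "chain_bump c i x = x"
  using bump_fixes[OF assms] PL_plus_inv_apply(2)[OF bump_PL_plus, of "2 * real i" x]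
  by (simp add: chain_bump_def)

lemma chain_prod_PL_plus: "chain_prod c k v \<in> carrier PL_plus"
  using PL.one_closed by (induction k) (auto intro: chain_bump_PL_plus PL_plus_comp simp del: id_apply)

lemma chain_prod_fixes:
  "(\<And>i. i < k \<Longrightarrow> fst (c ! i) = v \<Longrightarrow> x \<le> 2 * real i \<or> 2 * real i + 3 \<le> x) \<Longrightarrow>
    chain_prod c k v x = x"
  by (induction k) (auto simp: chain_bump_fixes)

text \<open>Factors of larger index act first and see \<open>x\<close>; those of smaller index act
  after the \<open>i\<close>-th bump and see \<open>y\<close>. All of them fix the point they
  see.\<close>

lemma chain_prod_single:
  assumes "i < k" "fst (c ! i) = v" "chain_bump c i x = y"
    and "\<And>j z. j < k \<Longrightarrow> j \<noteq> i \<Longrightarrow> fst (c ! j) = v \<Longrightarrow> z \<in> {x, y} \<Longrightarrow>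
      z \<le> 2 * real j \<or> 2 * real j + 3 \<le> z"
  shows "chain_prod c k v x = y"
  using assms(1,4)
proof (induction k)
  case (Suc k)
  show ?case
  proof (cases "i = k")
    case True
    have "chain_prod c k v y = y" by (rule chain_prod_fixes) (use Suc.prems True in auto)
    then show ?thesis using assms(2,3) True by simp
  next
    case False
    then have "chain_prod c k v x = y" using Suc by simp
    moreover have "chain_bump c k x = x" if "fst (c ! k) = v"
      using Suc.prems(2)[of k x] False that by (intro chain_bump_fixes) auto
    ultimately show ?thesis by auto
  qed
qed simp

lemma chain_bump_commute:
  assumes "Suc i < j"
  shows "chain_bump c i \<circ> chain_bump c j = chain_bump c j \<circ> chain_bump c i"
  by (rule disjoint_supports_commute[where b = "2 * real j"])
    (use assms in \<open>auto intro!: PL_plus_strict_mono chain_bump_PL_plus chain_bump_fixes\<close>)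

lemma chain_bump_prod_commute:
  assumes "\<And>j. j < k \<Longrightarrow> fst (c ! j) = v \<Longrightarrow> Suc i < j \<or> Suc j < i"
  shows "chain_bump c i \<circ> chain_prod c k v = chain_prod c k v \<circ> chain_bump c i"
  using assms
proof (induction k)
  case (Suc k)
  have IH: "chain_bump c i \<circ> chain_prod c k v = chain_prod c k v \<circ> chain_bump c i"
    by (intro Suc.IH) (simp add: Suc.prems)
  show ?case
  proof (cases "fst (c ! k) = v")
    case True
    then have "chain_bump c i \<circ> chain_bump c k = chain_bump c k \<circ> chain_bump c i"
      using Suc.prems[of k] chain_bump_commute[of i k c] chain_bump_commute[of k i c] by auto
    with IH True show ?thesis by (metis chain_prod.simps(2) comp_assoc)
  next
    case False
    then show ?thesis using IH by (simp only: chain_prod.simps if_False)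
  qed
qed simp

lemma chain_prod_commute:
  assumes "\<And>i j. i < k \<Longrightarrow> j < m \<Longrightarrow> fst (c ! i) = v \<Longrightarrow> fst (c ! j) = w \<Longrightarrow> Suc i < j \<or> Suc j < i"
  shows "chain_prod c k v \<circ> chain_prod c m w = chain_prod c m w \<circ> chain_prod c k v"
  using assms
proof (induction k)
  case (Suc k)
  have IH: "chain_prod c k v \<circ> chain_prod c m w = chain_prod c m w \<circ> chain_prod c k v"
    by (intro Suc.IH) (simp add: Suc.prems)
  show ?case
  proof (cases "fst (c ! k) = v")
    case True
    then have "chain_bump c k \<circ> chain_prod c m w = chain_prod c m w \<circ> chain_bump c k"
      using Suc.prems by (intro chain_bump_prod_commute) auto
    with IH True show ?thesis by (metis chain_prod.simps(2) comp_assoc)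
  next
    case False
    then show ?thesis using IH by (simp only: chain_prod.simps if_False)
  qed
qed simp

section \<open>Dynamics of a word along its own chain\<close>

context
  fixes E :: "'v set set" and t0 c :: "'v word" and F :: "'v \<Rightarrow> real \<Rightarrow> real"
  defines "c \<equiv> chain E t0" and "F \<equiv> chain_prod c (length c)"
begin

text \<open>Neighbouring positions carry dependent letters, so distinct positions with independent
  letters, in particular repetitions of one vertex, are at least two apart. Their bumps then have
  disjoint supports.\<close>

lemma chain_far_apart:
  assumes "i < length c" "j < length c" "\<not> dep E (fst (c ! i)) (fst (c ! j))" "i \<noteq> j"
  shows "Suc i < j \<or> Suc j < i"
proof -
  have "dep E v w = dep E w v" for v w by (auto simp: dep_def insert_commute)
  with assms chain_dep[of i E t0] chain_dep[of j E t0] have "j \<noteq> Suc i" "i \<noteq> Suc j"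
    unfolding c_def by auto
  with assms(4) show ?thesis by linarith
qed

lemma chain_gen_PL_plus: "F v \<in> carrier PL_plus"
  by (simp add: F_def chain_prod_PL_plus)

lemma letter_fixes: "F (fst l) x = x \<Longrightarrow> letter PL_plus F l x = x"
  using PL_plus_inv_apply(2)[OF chain_gen_PL_plus, of "fst l" x] by (simp add: letter_def)

text \<open>All other bumps of the same vertex lie away from [2i, 2i + 3], and the sign in
  \<open>chain_bump\<close> cancels the sign of the letter, so on these points the letter acts as
  \<open>bump (2 * real i)\<close>.\<close>

lemma chain_letter_advances:
  assumes i: "i < length c" and x: "2 * real i + 1/2 \<le> x" "x \<le> 2 * real i + 3"
  shows "2 * real i + 5/2 \<le> letter PL_plus F (c ! i) x \<and> letter PL_plus F (c ! i) x \<le> 2 * real i + 3"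
proof -
  define y where "y = bump (2 * real i) x"
  have y: "2 * real i + 5/2 \<le> y" "y \<le> 2 * real i + 3"
    using bump_expands[of "2 * real i" x] x by (auto simp: y_def)
  have far: "z \<le> 2 * real j \<or> 2 * real j + 3 \<le> z"
    if "j < length c" "j \<noteq> i" "fst (c ! j) = fst (c ! i)" "z \<in> {x, y}" for j z
  proof -
    have "Suc i < j \<or> Suc j < i"
      using that i chain_far_apart[of i j] by (auto simp: dep_def)
    moreover have "2 * real i \<le> z" "z \<le> 2 * real i + 3" using that(4) x y by auto
    ultimately show ?thesis by auto
  qed
  have "letter PL_plus F (c ! i) x = y"
  proof (cases "snd (c ! i)")
    case True
    then have "F (fst (c ! i)) x = y"
      unfolding F_def using far i
      by (intro chain_prod_single[of i]) (auto simp: chain_bump_def y_def)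
    with True show ?thesis by (simp add: letter_def)
  next
    \<comment> \<open>For an inverse letter the generator contains the inverse bump and so takes
      \<open>y\<close> back to \<open>x\<close>; inverting it gives the bump again.\<close>
    case False
    then have "F (fst (c ! i)) y = x"
      unfolding F_def using far i
      by (intro chain_prod_single[of i]) (auto simp: chain_bump_def y_def bump_PL_plus)
    with False show ?thesis
      using PL_plus_inv_apply(2)[OF chain_gen_PL_plus, of "fst (c ! i)" x]
        PL_plus_inv_apply(2)[OF chain_gen_PL_plus, of "fst (c ! i)" y]
      by (auto simp: letter_def)
  qed
  with y show ?thesis by simp
qed

text \<open>Only bumps \<open>i\<close> and \<open>i + 1\<close> can move the point. The vertex of
  \<open>l\<close> differs from the one at \<open>i\<close> by hypothesis, and from the one at
  \<open>i + 1\<close> because that one is dependent on the letter at \<open>i\<close>.\<close>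

lemma commuting_letter_fixes:
  assumes i: "i < length c" and x: "2 * real i + 5/2 \<le> x" "x \<le> 2 * real i + 3"
    and l: "fst l \<noteq> fst (c ! i)" "\<not> dep E (fst (c ! i)) (fst l)"
  shows "letter PL_plus F l x = x"
proof (rule letter_fixes)
  have "x \<le> 2 * real j \<or> 2 * real j + 3 \<le> x" if "j < length c" "fst (c ! j) = fst l" for j
  proof -
    have "i \<noteq> j" using that l by auto
    then have "Suc i < j \<or> Suc j < i"
      using l that by (intro chain_far_apart[OF i that(1)]) simp_all
    with x show ?thesis by auto
  qed
  then show "F (fst l) x = x" unfolding F_def by (intro chain_prod_fixes) auto
qed

text \<open>The window [2i + 5/2, 2i + 3] is mapped into itself by a repetition of
  \<open>c ! i\<close> and fixed pointwise by the other letters allowed.\<close>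

lemma letters_stay:
  assumes i: "i < length c" and "2 * real i + 5/2 \<le> x" "x \<le> 2 * real i + 3"
    and "\<And>l. l \<in> set q \<Longrightarrow> l = c ! i \<or> fst l \<noteq> fst (c ! i) \<and> \<not> dep E (fst (c ! i)) (fst l)"
  shows "2 * real i + 5/2 \<le> fold (letter PL_plus F) q x \<and> fold (letter PL_plus F) q x \<le> 2 * real i + 3"
  using assms(2-)
proof (induction q arbitrary: x)
  case (Cons l q)
  have "2 * real i + 5/2 \<le> letter PL_plus F l x \<and> letter PL_plus F l x \<le> 2 * real i + 3"
    using Cons.prems(3)[of l] chain_letter_advances[OF i, of x]
      commuting_letter_fixes[OF i Cons.prems(1,2), of l] Cons.prems(1,2)
    by auto
  then show ?case using Cons.IH[of "letter PL_plus F l x"] Cons.prems(3) by simp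
qed simp

text \<open>Before the next letter of the chain is reached, every letter either has a bump that does not
  contain the point or, since the word is reduced, repeats the current letter of the chain.\<close>

lemma reduced_word_advances:
  assumes "raag_reduced E t" "chain E t = drop i c"
    and "2 * real i + 1/2 \<le> x" "x \<le> 2 * real i + 1"
  shows "2 * real i + (if t = [] then 1/2 else 5/2) \<le> fold (letter PL_plus F) t x"
  using assms
\<comment> \<open>\<open>c\<close> and \<open>F\<close> come from the whole word \<open>t0\<close>,
  while \<open>t\<close> runs through its remaining suffixes and \<open>i\<close> counts the chain
  letters already used. A step drops a whole segment of letters, hence the induction on
  length.\<close>
proof (induction "length t" arbitrary: t i x rule: less_induct)
  case less
  show ?case
  proof (cases t)
    case Nil
    then show ?thesis using less.prems by simp
  next
    case (Cons s t')
    \<comment> \<open>\<open>q\<close> consists of the letters that the chain skips;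
      \<open>t''\<close> is empty or starts with the next chain letter.\<close>
    define q where "q = takeWhile (\<lambda>l. \<not> dep E (fst s) (fst l)) t'"
    define t'' where "t'' = dropWhile (\<lambda>l. \<not> dep E (fst s) (fst l)) t'"
    have t: "t = s # q @ t''" by (simp add: Cons q_def t''_def)
    have d: "drop i c = s # chain E t''" using less.prems(2) by (simp add: Cons t''_def)
    then have i: "i < length c" by (metis drop_eq_Nil2 list.distinct(1) not_less)
    have s: "c ! i = s" and ch: "chain E t'' = drop (Suc i) c"
      using d Cons_nth_drop_Suc[OF i] by auto
    have nd: "\<not> dep E (fst s) (fst l)" if "l \<in> set q" for l
      using that set_takeWhileD unfolding q_def by metis
    have q: "l = c ! i \<or> fst l \<noteq> fst (c ! i) \<and> \<not> dep E (fst (c ! i)) (fst l)"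
      if l: "l \<in> set q" for l
    proof (rule ccontr)
      assume "\<not> ?thesis"
      \<comment> \<open>The remaining possibility is the inverse of \<open>s\<close>; reducedness
        would then put a letter dependent on \<open>s\<close> between the two, but \<open>q\<close>
        has none.\<close>
      then have "l = (fst s, \<not> snd s)" using nd[OF l] s by (cases l; cases s) auto
      moreover obtain q1 q2 where q: "q = q1 @ l # q2" using split_list[OF l] by blast
      ultimately have "t = [] @ [(fst s, snd s)] @ q1 @ [(fst s, \<not> snd s)] @ (q2 @ t'')"
        by (simp add: t)
      then have "\<exists>l\<in>set q1. dep E (fst s) (fst l)"
        using less.prems(1) unfolding raag_reduced_def by blast
      with nd q show False by auto
    qed
    define y where "y = fold (letter PL_plus F) q (letter PL_plus F s x)"
    have "2 * real i + 5/2 \<le> y \<and> y \<le> 2 * real i + 3"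
      unfolding y_def using letters_stay[OF i _ _ q] chain_letter_advances[OF i, of x] less.prems s
      by auto
    moreover have "raag_reduced E t''"
      using less.prems(1) raag_reduced_appendD[of E "s # q" t''] by (simp add: t)
    \<comment> \<open>The window [2i + 5/2, 2i + 3] is [2(i + 1) + 1/2, 2(i + 1) + 1], the starting
      window for \<open>Suc i\<close>. If \<open>t''\<close> is empty, the value 1/2 already gives
      the bound wanted for \<open>t\<close>.\<close>
    ultimately have "2 * real (Suc i) + (if t'' = [] then 1/2 else 5/2)
        \<le> fold (letter PL_plus F) t'' y"
      using ch by (intro less.hyps) (auto simp: t)
    then show ?thesis by (auto simp: t y_def split: if_splits)
  qed
qed

text \<open>Adjacent vertices are independent and occupy different chain positions, so every bump of
  one is disjoint from every bump of the other.\<close>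

lemma chain_commutator:
  assumes "{v, w} \<in> E" "v \<noteq> w"
  shows "word_val PL_plus F (commutator_word v w) = \<one>\<^bsub>PL_plus\<^esub>"
proof -
  have "\<not> dep E v w" "\<not> dep E w v" using assms by (auto simp: dep_def insert_commute)
  then have "F v \<circ> F w = F w \<circ> F v"
    unfolding F_def using assms(2) chain_far_apart by (intro chain_prod_commute) auto
  then have "F v \<otimes>\<^bsub>PL_plus\<^esub> F w = F w \<otimes>\<^bsub>PL_plus\<^esub> F v" by simp
  then show ?thesis
    using PL.commutator_one_iff[OF chain_gen_PL_plus chain_gen_PL_plus, of v w]
      PL.inv_closed[OF chain_gen_PL_plus]
    by (simp add: commutator_word_def letter_def)
qed

text \<open>The product is composition, so letters act from right to left; this is why the chain is
  taken in \<open>rev u\<close>.\<close>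

lemma word_val_PL_plus: "word_val PL_plus F u x = fold (letter PL_plus F) (rev u) x"
  by (induction u) auto

text \<open>The last bump, if any, has index \<open>length c - 1\<close> and therefore ends at
  \<open>2 * real (length c) + 1\<close>.\<close>

lemma word_val_fixes:
  assumes "x \<le> 0 \<or> 2 * real (length c) + 1 \<le> x"
  shows "word_val PL_plus F u x = x"
proof (induction u)
  case (Cons l u)
  have "F (fst l) x = x"
    unfolding F_def using assms by (intro chain_prod_fixes) auto
  then show ?case using Cons letter_fixes by simp
qed simp

end

text \<open>A reduced word for \<open>a\<close> is nonempty, and its own chain drives 1/2 to at
  least 5/2. The bound \<open>L\<close>, common to all elements, makes the action rescalable to a
  unit interval.\<close>

lemma raag_separated_by_PL_plus:
  assumes E: "finite_simplicial_graph V E"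
    and a: "a \<in> carrier (raag V E)" "a \<noteq> \<one>\<^bsub>raag V E\<^esub>"
  obtains \<theta> L where "\<theta> \<in> hom (raag V E) PL_plus" "\<theta> a \<noteq> id" "L > 0"
    "\<And>b x. b \<in> carrier (raag V E) \<Longrightarrow> x \<le> 0 \<or> L \<le> x \<Longrightarrow> \<theta> b x = x"
proof -
  define R where "R = {commutator_word v w | v w. v \<in> V \<and> w \<in> V \<and> {v, w} \<in> E}"
  have raag: "raag V E = presented_group V R" by (simp add: raag_def R_def)
  obtain u where u: "u \<in> words_over V" "raag_reduced E u" "a = pres_rel V R `` {u}"
    using raag_reduced_representative[OF a(1)] unfolding R_def by blast
  define c where "c = chain E (rev u)"
  define F where "F = chain_prod c (length c)"
  \<comment> \<open>Edges have two elements, so there are no loops.\<close>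
  have "v \<noteq> w" if "{v, w} \<in> E" for v w
    using E that by (auto simp: finite_simplicial_graph_def)
  then have relators: "word_val PL_plus F r = \<one>\<^bsub>PL_plus\<^esub>" if r: "r \<in> R" for r
  proof -
    obtain v w where "r = commutator_word v w" "{v, w} \<in> E" using r unfolding R_def by blast
    with \<open>\<And>v w. {v, w} \<in> E \<Longrightarrow> v \<noteq> w\<close> show ?thesis
      unfolding F_def c_def by (metis chain_commutator)
  qed
  have "\<exists>\<theta>\<in>hom (presented_group V R) PL_plus.
      \<forall>u\<in>words_over V. \<theta> (pres_rel V R `` {u}) = word_val PL_plus F u"
  proof (rule PL.presented_group_hom)
    show "F v \<in> carrier PL_plus" for v unfolding F_def by (rule chain_prod_PL_plus)
  qed (rule relators)
  then obtain \<theta> where \<theta>: "\<theta> \<in> hom (raag V E) PL_plus"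
    "\<And>u. u \<in> words_over V \<Longrightarrow> \<theta> (pres_rel V R `` {u}) = word_val PL_plus F u"
    unfolding raag by blast
  have "u \<noteq> []" using a(2) u(3) by (auto simp: raag pres_one)
  then have "5/2 \<le> fold (letter PL_plus F) (rev u) (1/2)"
    using reduced_word_advances[where E = E and t = "rev u" and ?t0.0 = "rev u" and i = 0
        and x = "1/2"] raag_reduced_rev[OF u(2)]
    unfolding F_def c_def by simp
  also have "\<dots> = \<theta> a (1/2)"
    unfolding u(3) \<theta>(2)[OF u(1)] F_def c_def by (rule word_val_PL_plus[symmetric])
  finally have "\<theta> a (1/2) \<noteq> 1/2" by simp
  then have "\<theta> a \<noteq> id" by auto
  moreover have "\<theta> b x = x" if b: "b \<in> carrier (raag V E)" and "x \<le> 0 \<or> 2 * real (length c) + 1 \<le> x"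
    for b x
  proof -
    obtain v where v: "v \<in> words_over V" "b = pres_rel V R `` {v}"
      using b unfolding raag by (rule pres_carrierE)
    show ?thesis
      using that(2) unfolding v(2) \<theta>(2)[OF v(1)] F_def c_def by (rule word_val_fixes)
  qed
  moreover have "2 * real (length c) + 1 > 0" by simp
  ultimately show ?thesis using that \<theta>(1) by blast
qed

section \<open>Gluing\<close>

text \<open>Conjugation by the affine map \<open>A\<close>, which carries [0, L] onto
  [n, n + 1].\<close>

lemma rescaled_hom:
  assumes \<psi>: "\<psi> \<in> hom G PL_plus" and "L > 0"
    and outside: "\<And>g x. g \<in> carrier G \<Longrightarrow> x \<le> 0 \<or> L \<le> x \<Longrightarrow> \<psi> g x = x"
  obtains \<sigma> where "\<sigma> \<in> hom G PL_plus"
    "\<And>g x. g \<in> carrier G \<Longrightarrow> x \<le> n \<or> n + 1 \<le> x \<Longrightarrow> \<sigma> g x = x"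
    "\<And>g. g \<in> carrier G \<Longrightarrow> \<psi> g \<noteq> id \<Longrightarrow> \<sigma> g \<noteq> id"
proof
  define A where "A x = (1 / L) * x + n" for x
  define A' where "A' x = L * x + (- L * n)" for x
  define \<sigma> where "\<sigma> g = A \<circ> \<psi> g \<circ> A'" for g
  have A: "A (A' x) = x" "A' (A x) = x" for x
    using \<open>L > 0\<close> by (auto simp: A_def A'_def field_simps)
  have PL: "A \<in> carrier PL_plus" "A' \<in> carrier PL_plus"
    unfolding A_def A'_def using \<open>L > 0\<close> by (intro affine_PL_plus; simp)+
  show "\<sigma> \<in> hom G PL_plus"
  proof (rule homI)
    show "\<sigma> g \<in> carrier PL_plus" if "g \<in> carrier G" for g
      unfolding \<sigma>_def using PL that \<psi> by (intro PL_plus_comp) (auto simp: hom_def)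
    show "\<sigma> (g \<otimes>\<^bsub>G\<^esub> h) = \<sigma> g \<otimes>\<^bsub>PL_plus\<^esub> \<sigma> h" if "g \<in> carrier G" "h \<in> carrier G" for g h
      using hom_mult[OF \<psi> that] by (auto simp: \<sigma>_def A)
  qed
  show "\<sigma> g x = x" if "g \<in> carrier G" "x \<le> n \<or> n + 1 \<le> x" for g x
  proof -
    have "A' x \<le> 0 \<or> L \<le> A' x"
      using that(2) \<open>L > 0\<close> mult_left_mono[of x n L] mult_left_mono[of "n + 1" x L]
      by (auto simp: A'_def algebra_simps)
    then show ?thesis using outside that(1) by (simp add: \<sigma>_def A)
  qed
  show "\<sigma> g \<noteq> id" if "g \<in> carrier G" "\<psi> g \<noteq> id" for g
  proof
    assume "\<sigma> g = id"
    then have "A' (A (\<psi> g (A' (A x)))) = A' (A x)" for x by (simp add: \<sigma>_def fun_eq_iff)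
    then show False using that(2) by (auto simp: A fun_eq_iff)
  qed
qed

text \<open>\<open>nat\<close> turns negative floors into 0, so negative points are handed to
  \<open>f 0\<close>, which fixes them in the situation considered below.\<close>

definition glue :: "(nat \<Rightarrow> real \<Rightarrow> real) \<Rightarrow> real \<Rightarrow> real" where
  "glue f x = f (nat \<lfloor>x\<rfloor>) x"

context
  fixes f :: "nat \<Rightarrow> real \<Rightarrow> real"
  assumes PL: "\<And>n. f n \<in> carrier PL_plus"
    and fixes_outside: "\<And>n x. x \<le> real n \<or> real n + 1 \<le> x \<Longrightarrow> f n x = x"
begin

lemma nat_floor_bounds:
  assumes "0 \<le> (x :: real)"
  shows "real (nat \<lfloor>x\<rfloor>) \<le> x" "x < real (nat \<lfloor>x\<rfloor>) + 1"
  using assms by (simp_all add: floor_less_cancel)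

lemma block_invariant: "real n \<le> x \<and> x < real n + 1 \<Longrightarrow> real n \<le> f n x \<and> f n x < real n + 1"
  using strict_mono_less_eq[OF PL_plus_strict_mono[OF PL], of n "real n" x]
    strict_mono_less[OF PL_plus_strict_mono[OF PL], of n x "real n + 1"]
  by (simp add: fixes_outside)

text \<open>Each \<open>f n\<close> is increasing and fixes the endpoints of its block, so blocks
  are preserved. Hence glued maps compose block by block.\<close>

lemma nat_floor_glue: "nat \<lfloor>glue f x\<rfloor> = nat \<lfloor>x\<rfloor>"
proof (cases "0 \<le> x")
  case True
  then have "\<lfloor>glue f x\<rfloor> = int (nat \<lfloor>x\<rfloor>)"
    using block_invariant[of "nat \<lfloor>x\<rfloor>" x] nat_floor_bounds
    unfolding glue_def by (intro floor_unique) auto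
  then show ?thesis by simp
qed (simp add: glue_def fixes_outside)

lemma strict_mono_glue: "strict_mono (glue f)"
proof (rule strict_monoI)
  fix x y :: real assume xy: "x < y"
  show "glue f x < glue f y"
  proof (cases "nat \<lfloor>x\<rfloor> = nat \<lfloor>y\<rfloor>")
    case True
    then show ?thesis
      using strict_mono_less[OF PL_plus_strict_mono[OF PL]] xy by (simp add: glue_def)
  next
    case False
    moreover have "nat \<lfloor>x\<rfloor> \<le> nat \<lfloor>y\<rfloor>" using xy by (intro nat_mono floor_mono) simp
    ultimately have "nat \<lfloor>glue f x\<rfloor> < nat \<lfloor>glue f y\<rfloor>"
      by (metis le_neq_implies_less nat_floor_glue)
    then show ?thesis by (metis floor_mono nat_mono not_less)
  qed
qed

lemma piecewise_linear_glue: "piecewise_linear (glue f)"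
proof -
  have "\<exists>B. closed B \<and> discrete B \<and> (\<forall>C\<in>components (- B). \<exists>a b. \<forall>x\<in>C. f n x = a * x + b)" for n
    using PL[of n] by (simp add: PL_plus_def piecewise_linear_def)
  then obtain B where B: "\<And>n. closed (B n) \<and> discrete (B n)"
    "\<And>n. \<forall>C\<in>components (- B n). \<exists>a b. \<forall>x\<in>C. f n x = a * x + b"
    by metis
  \<comment> \<open>The block boundaries, together with the breakpoints of each \<open>f n\<close>
    inside its own block.\<close>
  define D where "D = range real \<union> (\<Union>n. B n \<inter> {real n..real n + 1})"
  have "\<not> x islimpt D" for x
  proof
    assume "x islimpt D"
    let ?U = "{x - 1/2<..<x + 1/2}" and ?m = "nat \<lfloor>x - 1\<rfloor>"
    have "eventually (\<lambda>y. y \<in> ?U) (at x)" by (rule eventually_at_in_open') auto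
    then have "x islimpt (D \<inter> ?U)" using \<open>x islimpt D\<close> by (intro islimpt_Int_eventually)
    \<comment> \<open>Only blocks beginning below \<open>x + 1/2\<close> meet \<open>?U\<close>, so
      near \<open>x\<close> finitely many of the sets \<open>B n\<close> matter, and a finite union
      of them has no limit point.\<close>
    moreover have "D \<inter> ?U \<subseteq> real ` {..?m + 3} \<union> (\<Union>n\<le>?m + 3. B n)"
    proof
      fix y assume y: "y \<in> D \<inter> ?U"
      have "n \<le> ?m + 3" if "real n \<le> y" for n using that y by (simp; linarith)
      with y show "y \<in> real ` {..?m + 3} \<union> (\<Union>n\<le>?m + 3. B n)" by (auto simp: D_def)
    qed
    ultimately have "x islimpt real ` {..?m + 3} \<union> (\<Union>n\<le>?m + 3. B n)" by (rule islimpt_subset)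
    then have "x islimpt (\<Union>n\<le>?m + 3. B n)" by (simp add: islimpt_Un islimpt_finite)
    moreover have "\<not> x islimpt (\<Union>n\<le>k. B n)" for k
      using B(1) by (induction k) (auto simp: closed_discrete_iff_no_limpt atMost_Suc islimpt_Un)
    ultimately show False by blast
  qed
  then have "closed D \<and> discrete D" by (simp add: closed_discrete_iff_no_limpt)
  moreover have "\<exists>a b. \<forall>x\<in>C. glue f x = a * x + b" if C: "C \<in> components (- D)" for C
  proof -
    have conn: "connected C" and ne: "C \<noteq> {}" and sub: "C \<subseteq> - D"
      using C in_components_connected in_components_nonempty in_components_subset by blast+
    \<comment> \<open>\<open>C\<close> avoids all natural numbers, so it cannot reach into two
      blocks.\<close>
    have le: "nat \<lfloor>y\<rfloor> \<le> nat \<lfloor>x\<rfloor>" if "x \<in> C" "y \<in> C" for x y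
    proof (rule ccontr)
      assume n: "\<not> ?thesis"
      then have "x < real (nat \<lfloor>y\<rfloor>)" "real (nat \<lfloor>y\<rfloor>) \<le> y" by linarith+
      moreover have "real (nat \<lfloor>y\<rfloor>) \<notin> C" using sub by (auto simp: D_def)
      ultimately show False using connected_avoids[OF conn, of "real (nat \<lfloor>y\<rfloor>)"] that by auto
    qed
    obtain x0 where x0: "x0 \<in> C" using ne by blast
    define n where "n = nat \<lfloor>x0\<rfloor>"
    have n: "nat \<lfloor>x\<rfloor> = n" if "x \<in> C" for x
      using le[OF that x0] le[OF x0 that] by (simp add: n_def)
    have "\<exists>a b. \<forall>x\<in>C. f n x = a * x + b"
    \<comment> \<open>Below 0 the set \<open>D\<close> omits the points of \<open>B 0\<close>, but
      there the map is the identity.\<close>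
    proof (cases "C \<subseteq> {..<0}")
      case True
      then have "\<forall>x\<in>C. f n x = 1 * x + 0" by (auto intro!: fixes_outside)
      then show ?thesis by blast
    next
      case False
      have "0 \<notin> C" using sub by (auto simp: D_def)
      then have "C \<subseteq> {0<..}" using connected_avoids[OF conn] False by blast
      then have "C \<subseteq> {real n..real n + 1}" using nat_floor_bounds n by (force simp: less_imp_le)
      then have "C \<inter> B n \<subseteq> D" unfolding D_def by blast
      then have "C \<subseteq> - B n" using sub by blast
      then show ?thesis using piecewise_linear_subset[OF B(2) conn ne] by blast
    qed
    then show ?thesis by (simp add: glue_def n)
  qed
  ultimately show ?thesis unfolding piecewise_linear_def by blast
qed

end

lemma glued_hom:
  assumes G: "group G" and \<sigma>: "\<And>n. \<sigma> n \<in> hom G PL_plus"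
    and outside: "\<And>n g x. g \<in> carrier G \<Longrightarrow> x \<le> real n \<or> real n + 1 \<le> x \<Longrightarrow> \<sigma> n g x = x"
  shows "(\<lambda>g. glue (\<lambda>n. \<sigma> n g)) \<in> hom G PL_plus"
proof -
  interpret group G by fact
  have PL: "\<sigma> n g \<in> carrier PL_plus" if "g \<in> carrier G" for n g
    using \<sigma> that by (auto simp: hom_def)
  have mult: "glue (\<lambda>n. \<sigma> n (g \<otimes>\<^bsub>G\<^esub> h)) = glue (\<lambda>n. \<sigma> n g) \<circ> glue (\<lambda>n. \<sigma> n h)"
    if g: "g \<in> carrier G" and h: "h \<in> carrier G" for g h
  proof
    fix x
    have "nat \<lfloor>glue (\<lambda>n. \<sigma> n h) x\<rfloor> = nat \<lfloor>x\<rfloor>" using h by (intro nat_floor_glue PL outside)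
    then show "glue (\<lambda>n. \<sigma> n (g \<otimes>\<^bsub>G\<^esub> h)) x = (glue (\<lambda>n. \<sigma> n g) \<circ> glue (\<lambda>n. \<sigma> n h)) x"
      using hom_mult[OF \<sigma> g h] by (simp add: glue_def)
  qed
  have one: "glue (\<lambda>n. \<sigma> n \<one>\<^bsub>G\<^esub>) = id"
    using hom_one[OF \<sigma> G group_PL_plus] by (auto simp: glue_def)
  show ?thesis
  proof (rule homI)
    fix g assume g: "g \<in> carrier G"
    \<comment> \<open>Surjectivity is obtained algebraically: gluing the images of the inverse of
      \<open>g\<close> gives a right inverse.\<close>
    have "glue (\<lambda>n. \<sigma> n g) \<circ> glue (\<lambda>n. \<sigma> n (inv\<^bsub>G\<^esub> g)) = id"
      using mult[OF g inv_closed[OF g]] g one by simp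
    then have "surj (glue (\<lambda>n. \<sigma> n g))" by (metis comp_apply id_apply surjI)
    then show "glue (\<lambda>n. \<sigma> n g) \<in> carrier PL_plus"
      using g by (intro PL_plusI strict_mono_glue piecewise_linear_glue PL outside)
  qed (simp add: mult)
qed

section \<open>Embedding a countable residually RAAG group\<close>

theorem corollary3:
  fixes G :: "('g, 'm) monoid_scheme"
  assumes "group G"
    and "countable (carrier G)"
    and "residually_RAAG G"
  shows "\<exists>\<phi>. \<phi> \<in> hom G PL_plus \<and> inj_on \<phi> (carrier G)"
proof -
  interpret G: group G by fact
  \<comment> \<open>The identity is included, with the trivial action, so that every term of an
    enumeration of the group can be given a block.\<close>
  have sep: "\<exists>\<sigma>. \<sigma> \<in> hom G PL_plus \<and>
      (\<forall>h\<in>carrier G. \<forall>x. x \<le> real n \<or> real n + 1 \<le> x \<longrightarrow> \<sigma> h x = x) \<and> (g \<noteq> \<one>\<^bsub>G\<^esub> \<longrightarrow> \<sigma> g \<noteq> id)"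
    if g: "g \<in> carrier G" for g n
  proof (cases "g = \<one>\<^bsub>G\<^esub>")
    case True
    have "(\<lambda>_. \<one>\<^bsub>PL_plus\<^esub>) \<in> hom G PL_plus" by (rule homI) (use PL.one_closed in simp_all)
    with True show ?thesis by (intro exI[of _ "\<lambda>_. \<one>\<^bsub>PL_plus\<^esub>"]) simp
  next
    case False
    with assms(3) g obtain V :: "nat set" and E \<phi> where V: "finite_simplicial_graph V E"
      and \<phi>: "\<phi> \<in> hom G (raag V E)" "\<phi> g \<noteq> \<one>\<^bsub>raag V E\<^esub>"
      unfolding residually_RAAG_def by blast
    have closed: "\<phi> h \<in> carrier (raag V E)" if "h \<in> carrier G" for h
      using \<phi>(1) that by (auto simp: hom_def)
    obtain \<theta> L where \<theta>: "\<theta> \<in> hom (raag V E) PL_plus" "\<theta> (\<phi> g) \<noteq> id" "L > 0"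
      "\<And>b x. b \<in> carrier (raag V E) \<Longrightarrow> x \<le> 0 \<or> L \<le> x \<Longrightarrow> \<theta> b x = x"
      using raag_separated_by_PL_plus[OF V closed[OF g] \<phi>(2)] by blast
    have "(\<theta> \<circ> \<phi>) h x = x" if "h \<in> carrier G" "x \<le> 0 \<or> L \<le> x" for h x
      using \<theta>(4)[OF closed[OF that(1)] that(2)] by simp
    with hom_compose[OF \<phi>(1) \<theta>(1)] \<theta>(3)
    obtain \<sigma> where "\<sigma> \<in> hom G PL_plus"
      "\<And>h x. h \<in> carrier G \<Longrightarrow> x \<le> real n \<or> real n + 1 \<le> x \<Longrightarrow> \<sigma> h x = x"
      "\<And>h. h \<in> carrier G \<Longrightarrow> (\<theta> \<circ> \<phi>) h \<noteq> id \<Longrightarrow> \<sigma> h \<noteq> id"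
      by (rule rescaled_hom[where n = "real n"]) (assumption | rule that; assumption)+
    with g \<theta>(2) show ?thesis by (intro exI[of _ \<sigma>]) auto
  qed
  \<comment> \<open>An enumeration that also serves finite groups, with repetitions; it only has to
    hit every element.\<close>
  define e where "e = from_nat_into (carrier G)"
  have ne: "carrier G \<noteq> {}" using G.one_closed by blast
  have "\<forall>n. \<exists>\<sigma>. \<sigma> \<in> hom G PL_plus \<and>
      (\<forall>h\<in>carrier G. \<forall>x. x \<le> real n \<or> real n + 1 \<le> x \<longrightarrow> \<sigma> h x = x) \<and>
      (e n \<noteq> \<one>\<^bsub>G\<^esub> \<longrightarrow> \<sigma> (e n) \<noteq> id)"
    by (intro allI sep) (simp add: e_def from_nat_into[OF ne])
  from choice[OF this] obtain \<sigma> where \<sigma>: "\<And>n. \<sigma> n \<in> hom G PL_plus"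
    "\<And>n h x. h \<in> carrier G \<Longrightarrow> x \<le> real n \<or> real n + 1 \<le> x \<Longrightarrow> \<sigma> n h x = x"
    "\<And>n. e n \<noteq> \<one>\<^bsub>G\<^esub> \<Longrightarrow> \<sigma> n (e n) \<noteq> id"
    by blast
  define \<Phi> where "\<Phi> g = glue (\<lambda>n. \<sigma> n g)" for g
  have hom: "\<Phi> \<in> hom G PL_plus"
    unfolding \<Phi>_def using assms(1) \<sigma>(1,2) by (rule glued_hom)
  have "g = \<one>\<^bsub>G\<^esub>" if g: "g \<in> carrier G" "\<Phi> g = \<one>\<^bsub>PL_plus\<^esub>" for g
  proof (rule ccontr)
    assume "g \<noteq> \<one>\<^bsub>G\<^esub>"
    obtain n where n: "e n = g" using from_nat_into_surj[OF assms(2) g(1)] unfolding e_def by blast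
    then obtain x where x: "\<sigma> n g x \<noteq> x" using \<sigma>(3)[of n] \<open>g \<noteq> \<one>\<^bsub>G\<^esub>\<close> by (auto simp: fun_eq_iff)
    \<comment> \<open>A point moved by the \<open>n\<close>-th action lies in the
      \<open>n\<close>-th block, where the glued map agrees with that action.\<close>
    then have "real n \<le> x" "x < real n + 1" using \<sigma>(2)[OF g(1), of x n] by force+
    then have "nat \<lfloor>x\<rfloor> = n" by linarith
    then have "\<Phi> g x \<noteq> x" using x by (simp add: \<Phi>_def glue_def)
    with g(2) show False by simp
  qed
  then have "inj_on \<Phi> (carrier G)" using inj_on_one_iff'[OF hom assms(1) group_PL_plus] by blast
  with hom show ?thesis by blast
qed

end
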